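(* The algebra $\mathbb{T}$ is the direct sum of its ideals $\mathbb{D}$ and $\mathbb{G}$. Moreover, the algebra $\mathbb{T}$ is isomorphic (as a real algebra) to $\mathbb{C}\times\mathbb{R}$.
   Context: $\mathbb{T}$ denotes the real vector space $\mathbb{R}^3$ with basis $\mathbf{1}_{\mathbb{T}}=(1,0,0)$, $\mathbf{u}=(0,1,0)$, $\mathbf{v}=(0,0,1)$ and multiplication $$(X_1,X_u,X_v)\otimes(Y_1,Y_u,Y_v)=\big(X_1Y_1-X_uY_v-X_vY_u,\; X_1Y_u+X_uY_1-X_vY_v,\; X_1Y_v+X_uY_u+X_vY_1\big).$$ It is a commutative associative real algebra with identity $\mathbf{1}_{\mathbb{T}}$. For $\mathbf{x}=(X_1,X_u,X_v)$ put $A(\mathbf{x})=X_1^2+X_u^2+X_v^2$ and $B(\mathbf{x})=X_1X_u+X_uX_v-X_vX_1$. Then $$\mathbb{D}=\{\Gamma\in\mathbb{T}\mid A(\Gamma)+B(\Gamma)=0\}$$ (equivalently $\mathbb{D}=\{(\gamma,-\gamma,\gamma)\mid\gamma\in\mathbb{R}\}$), and $$\mathbb{G}=\{(\alpha-\beta,\alpha,\beta)\mid\alpha,\beta\in\mathbb{R}\}.$$ An ideal of a unital algebra is a linear subspace which is also a ring ideal. The algebra $\mathbb{C}\times\mathbb{R}$ has componentwise operations. *)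

theory Defs
  imports "HOL-Analysis.Product_Vector"
begin

text \<open>Real triples in their own type, so that the algebra structure can be given by type class
  instances (componentwise addition and scaling).\<close>

datatype tnum = TNum (comp_1: real) (comp_u: real) (comp_v: real)

lemma tnum_eq_iff:
  "x = y \<longleftrightarrow> comp_1 x = comp_1 y \<and> comp_u x = comp_u y \<and> comp_v x = comp_v y"
  by (cases x; cases y) simp

instantiation tnum :: comm_ring_1
begin

definition zero_tnum_def: "0 = TNum 0 0 0"
definition one_tnum_def: "1 = TNum 1 0 0"
definition plus_tnum_def:
  "x + y = TNum (comp_1 x + comp_1 y) (comp_u x + comp_u y) (comp_v x + comp_v y)"
definition uminus_tnum_def:
  "- x = TNum (- comp_1 x) (- comp_u x) (- comp_v x)"
definition minus_tnum_def:
  "x - y = TNum (comp_1 x - comp_1 y) (comp_u x - comp_u y) (comp_v x - comp_v y)"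
definition times_tnum_def:
  "x * y = TNum
     (comp_1 x * comp_1 y - comp_u x * comp_v y - comp_v x * comp_u y)
     (comp_1 x * comp_u y + comp_u x * comp_1 y - comp_v x * comp_v y)
     (comp_1 x * comp_v y + comp_u x * comp_u y + comp_v x * comp_1 y)"

instance
  by standard
    (simp_all add: tnum_eq_iff zero_tnum_def one_tnum_def plus_tnum_def uminus_tnum_def
       minus_tnum_def times_tnum_def algebra_simps)

end

instantiation tnum :: real_algebra_1
begin

definition scaleR_tnum_def:
  "r *\<^sub>R x = TNum (r * comp_1 x) (r * comp_u x) (r * comp_v x)"

instance
  by standard
    (simp_all add: tnum_eq_iff plus_tnum_def times_tnum_def scaleR_tnum_def algebra_simps)

end

text \<open>The library provides addition and scalar multiplication on pairs, but no multiplication.\<close>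

instantiation prod :: (real_algebra_1, real_algebra_1) real_algebra_1
begin

definition one_prod_def: "1 = (1, 1)"
definition times_prod_def: "x * y = (fst x * fst y, snd x * snd y)"

instance
  by standard
    (simp_all add: prod_eq_iff one_prod_def times_prod_def algebra_simps)

end

definition quad_A :: "tnum \<Rightarrow> real" where
  "quad_A x = (comp_1 x)\<^sup>2 + (comp_u x)\<^sup>2 + (comp_v x)\<^sup>2"

definition quad_B :: "tnum \<Rightarrow> real" where
  "quad_B x = comp_1 x * comp_u x + comp_u x * comp_v x - comp_v x * comp_1 x"

definition set_D :: "tnum set" where
  "set_D = {x. quad_A x + quad_B x = 0}"

definition set_G :: "tnum set" where
  "set_G = {TNum (\<alpha> - \<beta>) \<alpha> \<beta> | \<alpha> \<beta>. True}"

definition algebra_ideal :: "'a::real_algebra_1 set \<Rightarrow> bool" where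
  "algebra_ideal I \<longleftrightarrow> subspace I \<and> (\<forall>a. \<forall>x\<in>I. a * x \<in> I \<and> x * a \<in> I)"

definition is_direct_sum :: "'a::real_vector set \<Rightarrow> 'a set \<Rightarrow> bool" where
  "is_direct_sum U W \<longleftrightarrow> subspace U \<and> subspace W \<and>
     (\<forall>x. \<exists>!p. p \<in> U \<times> W \<and> x = fst p + snd p)"

definition algebra_isomorphism :: "('a::real_algebra_1 \<Rightarrow> 'b::real_algebra_1) \<Rightarrow> bool" where
  "algebra_isomorphism f \<longleftrightarrow>
     linear f \<and> bij f \<and> f 1 = 1 \<and> (\<forall>x y. f (x * y) = f x * f y)"

end

theory Submission
  imports Defs
begin

text \<open>Since \<open>u\<^sup>2 = v\<close> and \<open>u v = -1\<close>, the algebra is \<open>\<real>[u] / (u\<^sup>3 + 1)\<close>. Evaluating \<open>u\<close> at the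
  roots \<open>(1 + i \<surd>3) / 2\<close> and \<open>-1\<close> of \<open>u\<^sup>3 + 1\<close> gives the isomorphism to \<open>\<complex> \<times> \<real>\<close>. The ideal \<open>\<D>\<close>
  is the kernel of the complex evaluation and \<open>\<G>\<close> that of the real one.\<close>

lemmas tnum_ops = zero_tnum_def one_tnum_def plus_tnum_def times_tnum_def scaleR_tnum_def

text \<open>Twice the quadratic form \<open>quad_A x + quad_B x\<close> is a sum of three squares,
  so it vanishes only if each square does.\<close>

lemma mem_set_D_iff: "x \<in> set_D \<longleftrightarrow> comp_u x = - comp_1 x \<and> comp_v x = comp_1 x"
proof -
  have "2 * (quad_A x + quad_B x)
      = (comp_1 x + comp_u x)\<^sup>2 + (comp_u x + comp_v x)\<^sup>2 + (comp_1 x - comp_v x)\<^sup>2"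
    by (simp add: quad_A_def quad_B_def power2_eq_square algebra_simps)
  then have "x \<in> set_D \<longleftrightarrow>
      (comp_1 x + comp_u x)\<^sup>2 + (comp_u x + comp_v x)\<^sup>2 + (comp_1 x - comp_v x)\<^sup>2 = 0"
    by (auto simp: set_D_def)
  then show ?thesis
    by (auto simp: add_nonneg_eq_0_iff)
qed

lemma mem_set_G_iff: "x \<in> set_G \<longleftrightarrow> comp_1 x = comp_u x - comp_v x"
  by (auto simp: set_G_def tnum_eq_iff)

lemma algebra_ideal_set_D: "algebra_ideal set_D"
  unfolding algebra_ideal_def subspace_def
  by (auto simp: mem_set_D_iff tnum_ops algebra_simps)

lemma algebra_ideal_set_G: "algebra_ideal set_G"
  unfolding algebra_ideal_def subspace_def
  by (auto simp: mem_set_G_iff tnum_ops) (simp_all add: algebra_simps)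

lemma is_direct_sum_set_D_set_G: "is_direct_sum set_D set_G"
  unfolding is_direct_sum_def
proof (intro conjI allI)
  show "subspace set_D" "subspace set_G"
    using algebra_ideal_set_D algebra_ideal_set_G by (simp_all add: algebra_ideal_def)
next
  fix x :: tnum
  \<comment> \<open>The functional \<open>comp_1 x - comp_u x + comp_v x\<close> is zero on
    \<open>set_G\<close> and equals \<open>3 * c\<close> at \<open>TNum c (- c) c\<close>; this
    forces the component of \<open>x\<close> in \<open>set_D\<close>.\<close>
  define c where "c = (comp_1 x - comp_u x + comp_v x) / 3"
  define d where "d = TNum c (- c) c"
  have c: "3 * c = comp_1 x - comp_u x + comp_v x"
    by (simp add: c_def)
  show "\<exists>!p. p \<in> set_D \<times> set_G \<and> x = fst p + snd p"
  proof (rule ex1I[of _ "(d, x - d)"])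
    show "(d, x - d) \<in> set_D \<times> set_G \<and> x = fst (d, x - d) + snd (d, x - d)"
      using c by (simp add: d_def mem_set_D_iff mem_set_G_iff minus_tnum_def plus_tnum_def tnum_eq_iff)
  next
    fix p assume p: "p \<in> set_D \<times> set_G \<and> x = fst p + snd p"
    then have "fst p = d"
      using c by (auto simp: d_def mem_set_D_iff mem_set_G_iff plus_tnum_def tnum_eq_iff)
    with p show "p = (d, x - d)"
      by (simp add: prod_eq_iff)
  qed
qed

lemma sqrt_3_mult_sqrt_3_mult: "sqrt 3 * (sqrt 3 * a) = 3 * a"
  by (simp flip: mult.assoc)

text \<open>As the square of \<open>u\<close>, the basis element \<open>v\<close> is sent to (-1 + i
  sqrt 3) / 2 in the first factor and to 1 in the second.\<close>

definition tnum_to_prod :: "tnum \<Rightarrow> complex \<times> real" where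
  "tnum_to_prod x =
     (Complex (comp_1 x + (comp_u x - comp_v x) / 2) (sqrt 3 / 2 * (comp_u x + comp_v x)),
      comp_1 x - comp_u x + comp_v x)"

lemma linear_tnum_to_prod: "linear tnum_to_prod"
  by (rule linearI)
    (simp_all add: tnum_to_prod_def tnum_ops complex_eq_iff field_simps)

lemma tnum_to_prod_mult: "tnum_to_prod (x * y) = tnum_to_prod x * tnum_to_prod y"
  by (simp add: tnum_to_prod_def times_prod_def times_tnum_def complex_eq_iff
      sqrt_3_mult_sqrt_3_mult field_simps)

lemma bij_tnum_to_prod: "bij tnum_to_prod"
proof -
  \<comment> \<open>For (z, r) the image of x, the inverse is read off from
    \<open>2 * Re z + r = 3 * comp_1 x\<close>, while \<open>Re z - r\<close> and
    \<open>Im z\<close> determine the difference and the sum of \<open>comp_u x\<close> and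
    \<open>comp_v x\<close>.\<close>
  define g :: "complex \<times> real \<Rightarrow> tnum" where
    "g = (\<lambda>(z, r). TNum ((2 * Re z + r) / 3) (Im z / sqrt 3 + (Re z - r) / 3)
                        (Im z / sqrt 3 - (Re z - r) / 3))"
  have "g (tnum_to_prod x) = x" for x
    by (simp add: g_def tnum_to_prod_def tnum_eq_iff field_simps)
  moreover have "tnum_to_prod (g p) = p" for p
    by (simp add: g_def tnum_to_prod_def prod_eq_iff complex_eq_iff split_beta
        sqrt_3_mult_sqrt_3_mult field_simps)
  ultimately show ?thesis
    by (intro o_bij[of g]) (auto simp: fun_eq_iff)
qed

lemma algebra_isomorphism_tnum_to_prod: "algebra_isomorphism tnum_to_prod"
  unfolding algebra_isomorphism_def
  by (simp add: linear_tnum_to_prod bij_tnum_to_prod tnum_to_prod_mult)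
    (simp add: tnum_to_prod_def one_tnum_def one_prod_def complex_eq_iff)

theorem theorem3:
  shows "(algebra_ideal set_D \<and> algebra_ideal set_G \<and> is_direct_sum set_D set_G) \<and>
    (\<exists>f :: tnum \<Rightarrow> complex \<times> real. algebra_isomorphism f)"
  using algebra_ideal_set_D algebra_ideal_set_G is_direct_sum_set_D_set_G
    algebra_isomorphism_tnum_to_prod by blast

end
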